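(* Let $\mathbb{K}$ be an algebraically closed field, let $n,r\ge1$, and let $F_n=\mathbb{K}\langle z_1,\ldots,z_n\rangle$ be the free associative algebra. Then any effective regular action $\sigma$ of the algebraic torus $\mathbb{T}_r$ on $F_n$ with positive roots is linearizable.
   Context: $\mathbb{T}_r=(\mathbb{K}^\times)^r$. A regular action of $\mathbb{T}_r$ on $F_n$ is a $\mathbb{K}$-algebra homomorphism $\sigma:F_n\to F_n\otimes\mathbb{K}[t_1^{\pm1},\ldots,t_r^{\pm1}]$ whose specializations $\sigma(t)$, $t\in\mathbb{T}_r$, satisfy $\sigma(1)=\mathrm{id}$ and $\sigma(s)\circ\sigma(t)=\sigma(st)$. It is effective if $\sigma(t)\ne\mathrm{id}$ for all $t\neq1$. Positive roots: after a translation of the generators $z_i\mapsto z_i-c_i$ ($c_i\in\mathbb{K}$) for which all images of the new generators have zero constant term, let $\sigma_1(t)$ be the linear part of $\sigma(t)$, i.e. the linear map formed by the degree one components of the images of the generators. Its eigenvalues are $\lambda_i=\prod_{j=1}^r t_j^{k_{ij}}$, $i=1,\ldots,n$, with $k_{ij}\in\mathbb{Z}$. The action has positive roots if all $k_{ij}\geq 0$ and for every $i$ there exists $j$ with $k_{ij}\ne0$. The action is linear if every $\sigma(t)$ maps each $z_i$ to a $\mathbb{K}$-linear combination of $z_1,\ldots,z_n$; it is linearizable if there is an automorphism $\beta$ of $F_n$ such that $t\mapsto\beta^{-1}\circ\sigma(t)\circ\beta$ is linear. *)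

theory Defs
  imports "HOL-Analysis.Analysis" "HOL-Library.Poly_Mapping" "HOL-Computational_Algebra.Polynomial"
begin

section \<open>The free associative algebra\<close>

text \<open>
  The free algebra on generators indexed by a finite nonempty type \<open>'n\<close> is the monoid algebra of the
  free monoid on \<open>'n\<close>. The product of \<^typ>\<open>'a \<Rightarrow>\<^sub>0 'b\<close> is convolution along the \<^emph>\<open>additive\<close>
  structure of \<open>'a\<close>, hence concatenation of words is written additively.
\<close>

datatype 'n free_word = Word "'n list"

instantiation free_word :: (type) monoid_add
begin

definition zero_free_word :: "'a free_word" where
  "zero_free_word = Word []"

fun plus_free_word :: "'a free_word \<Rightarrow> 'a free_word \<Rightarrow> 'a free_word" where
  "plus_free_word (Word u) (Word v) = Word (u @ v)"

instance
proof
  fix a b c :: "'a free_word"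
  show "a + b + c = a + (b + c)" by (cases a; cases b; cases c) simp
  show "0 + a = a" by (cases a) (simp add: zero_free_word_def)
  show "a + 0 = a" by (cases a) (simp add: zero_free_word_def)
qed

end

type_synonym ('n, 'k) free_algebra = "'n free_word \<Rightarrow>\<^sub>0 'k"

definition gen :: "'n \<Rightarrow> ('n, 'k::zero_neq_one) free_algebra" where
  "gen i = Poly_Mapping.single (Word [i]) 1"

definition const :: "'k \<Rightarrow> 'a::zero \<Rightarrow>\<^sub>0 'k::zero" where
  "const c = Poly_Mapping.single 0 c"

definition const_term :: "('n, 'k::zero) free_algebra \<Rightarrow> 'k" where
  "const_term f = Poly_Mapping.lookup f 0"

text \<open>
  A \<open>\<bbbK>\<close>-algebra is given by a ring together with its structure map from \<open>\<bbbK>\<close>; compatibility with the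
  structure maps makes a ring homomorphism unital and \<open>\<bbbK>\<close>-linear.
\<close>

definition alg_hom :: "('k \<Rightarrow> 'a::ring_1) \<Rightarrow> ('k \<Rightarrow> 'b::ring_1) \<Rightarrow> ('a \<Rightarrow> 'b) \<Rightarrow> bool" where
  "alg_hom \<iota> \<kappa> h \<longleftrightarrow>
     (\<forall>x y. h (x + y) = h x + h y) \<and> (\<forall>x y. h (x * y) = h x * h y) \<and> (\<forall>c. h (\<iota> c) = \<kappa> c)"

definition free_algebra_aut :: "(('n, 'k::field) free_algebra \<Rightarrow> ('n, 'k) free_algebra) \<Rightarrow> bool" where
  "free_algebra_aut \<beta> \<longleftrightarrow> alg_hom const const \<beta> \<and> bij \<beta>"

fun word_eval :: "('n \<Rightarrow> 'a::monoid_mult) \<Rightarrow> 'n free_word \<Rightarrow> 'a" where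
  "word_eval g (Word w) = prod_list (map g w)"

text \<open>The algebra endomorphism \<open>z\<^sub>i \<mapsto> g i\<close>:\<close>

definition subst ::
    "('n \<Rightarrow> ('n, 'k::field) free_algebra) \<Rightarrow> ('n, 'k) free_algebra \<Rightarrow> ('n, 'k) free_algebra" where
  "subst g f = (\<Sum>w\<in>Poly_Mapping.keys f. const (Poly_Mapping.lookup f w) * word_eval g w)"

section \<open>Torus actions\<close>

definition torus :: "('k::field ^ 'r) set" where
  "torus = {t. \<forall>j. t $ j \<noteq> 0}"

text \<open>
  Laurent polynomials form the group algebra of \<open>\<int>\<^sup>r\<close>, and the tensor product of the free algebra with
  them is the free algebra with Laurent polynomial coefficients.
\<close>

type_synonym ('r, 'k) laurent = "(int ^ 'r) \<Rightarrow>\<^sub>0 'k"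

type_synonym ('n, 'r, 'k) coaction = "('n, 'k) free_algebra \<Rightarrow> ('n, ('r, 'k) laurent) free_algebra"

definition character :: "int ^ 'r \<Rightarrow> 'k::field ^ 'r \<Rightarrow> 'k" where
  "character a t = (\<Prod>j\<in>UNIV. (t $ j) powi (a $ j))"

definition laurent_eval :: "'k::field ^ 'r \<Rightarrow> ('r, 'k) laurent \<Rightarrow> 'k" where
  "laurent_eval t p = (\<Sum>a\<in>Poly_Mapping.keys p. Poly_Mapping.lookup p a * character a t)"

definition specialize ::
    "('n, 'r, 'k::field) coaction \<Rightarrow> 'k ^ 'r \<Rightarrow> ('n, 'k) free_algebra \<Rightarrow> ('n, 'k) free_algebra" where
  "specialize \<sigma> t f = Poly_Mapping.map (laurent_eval t) (\<sigma> f)"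

definition regular_action :: "('n, 'r::finite, 'k::field) coaction \<Rightarrow> bool" where
  "regular_action \<sigma> \<longleftrightarrow>
     alg_hom const (\<lambda>c. const (const c)) \<sigma> \<and>
     specialize \<sigma> 1 = id \<and>
     (\<forall>s\<in>torus. \<forall>t\<in>torus. specialize \<sigma> s \<circ> specialize \<sigma> t = specialize \<sigma> (s * t))"

definition effective :: "('n, 'r::finite, 'k::field) coaction \<Rightarrow> bool" where
  "effective \<sigma> \<longleftrightarrow> (\<forall>t\<in>torus. t \<noteq> 1 \<longrightarrow> specialize \<sigma> t \<noteq> id)"

section \<open>Positive roots\<close>

definition translation :: "'k::field ^ 'n \<Rightarrow> ('n, 'k) free_algebra \<Rightarrow> ('n, 'k) free_algebra" where
  "translation c = subst (\<lambda>i. gen i - const (c $ i))"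

text \<open>
  The endomorphism \<open>\<phi>\<close> written in the generators \<open>y\<^sub>i = z\<^sub>i - c\<^sub>i\<close>: the image of \<open>z\<^sub>i\<close> is \<open>\<phi>(y\<^sub>i)\<close>
  with every \<open>z\<^sub>j\<close> replaced by \<open>z\<^sub>j + c\<^sub>j\<close>, so that \<open>z\<^sub>j\<close> now stands for \<open>y\<^sub>j\<close>.
\<close>

definition translated :: "'k::field ^ 'n \<Rightarrow> (('n, 'k) free_algebra \<Rightarrow> ('n, 'k) free_algebra)
    \<Rightarrow> ('n, 'k) free_algebra \<Rightarrow> ('n, 'k) free_algebra" where
  "translated c \<phi> = translation (- c) \<circ> \<phi> \<circ> translation c"

text \<open>Column \<open>i\<close> holds the degree one coefficients of the image of \<open>z\<^sub>i\<close>.\<close>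

definition linear_part :: "(('n, 'k::field) free_algebra \<Rightarrow> ('n, 'k) free_algebra) \<Rightarrow> 'k ^ 'n ^ 'n" where
  "linear_part \<phi> = (\<chi> j i. Poly_Mapping.lookup (\<phi> (gen i)) (Word [j]))"

definition charpoly :: "'k::field ^ 'n ^ 'n \<Rightarrow> 'k poly" where
  "charpoly A = det (mat [:0, 1:] - (\<chi> i j. [:A $ i $ j:]))"

text \<open>Eigenvalues are counted with algebraic multiplicity, as roots of the characteristic polynomial.\<close>

definition has_eigenvalues :: "'k::field ^ 'n ^ 'n \<Rightarrow> ('n \<Rightarrow> 'k) \<Rightarrow> bool" where
  "has_eigenvalues A ev \<longleftrightarrow> charpoly A = (\<Prod>i\<in>UNIV. [:- ev i, 1:])"

definition positive_roots :: "('n::finite, 'r::finite, 'k::field) coaction \<Rightarrow> bool" where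
  "positive_roots \<sigma> \<longleftrightarrow>
     (\<exists>c. (\<forall>t\<in>torus. \<forall>i. const_term (translated c (specialize \<sigma> t) (gen i)) = 0) \<and>
          (\<exists>k :: 'n \<Rightarrow> int ^ 'r.
             (\<forall>t\<in>torus. has_eigenvalues (linear_part (translated c (specialize \<sigma> t)))
                                        (\<lambda>i. character (k i) t)) \<and>
             (\<forall>i j. 0 \<le> k i $ j) \<and>
             (\<forall>i. \<exists>j. k i $ j \<noteq> 0)))"

section \<open>Linearizability\<close>

definition linear_endo :: "(('n::finite, 'k::field) free_algebra \<Rightarrow> ('n, 'k) free_algebra) \<Rightarrow> bool" where
  "linear_endo \<phi> \<longleftrightarrow> (\<forall>i. \<exists>a :: 'n \<Rightarrow> 'k. \<phi> (gen i) = (\<Sum>j\<in>UNIV. const (a j) * gen j))"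

definition linearizable :: "('n::finite, 'r::finite, 'k::field) coaction \<Rightarrow> bool" where
  "linearizable \<sigma> \<longleftrightarrow>
     (\<exists>\<beta>. free_algebra_aut \<beta> \<and> (\<forall>t\<in>torus. linear_endo (inv \<beta> \<circ> specialize \<sigma> t \<circ> \<beta>)))"

end

theory Submission
  imports Defs
begin

text \<open>
  After the translation the action preserves the augmentation ideal \<open>I\<close>. The coefficients of the coaction
  decompose every element into weight vectors, so there are weight vectors \<open>y\<^sub>i\<close> whose linear parts form
  a basis of \<open>I/I\<^sup>2\<close>. The weights of the \<open>y\<^sub>i\<close> are eigenvalues of the linear part of the action, and
  restricting to the diagonal of the torus shows that they have positive degree, whence \<open>y\<^sub>i \<in> I\<close>.
  The endomorphism \<open>\<beta>: z\<^sub>i \<mapsto> y\<^sub>i\<close> is invertible on the graded algebra of the \<open>I\<close>-adic filtration, hence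
  injective with dense image. A weight vector of degree \<open>m\<close> can only be approximated by images of
  combinations of words of length at most \<open>m\<close>, so it lies in the image, and \<open>\<beta>\<close> is an automorphism that
  diagonalizes the action.
\<close>

section \<open>Monoid algebras\<close>

text \<open>Setting a value at a key outside the support amounts to adding a monomial, so additive
  identities have to be checked on monomials only.\<close>

lemma poly_mapping_add_induct [case_names add single]:
  assumes add: "\<And>p q. P p \<Longrightarrow> P q \<Longrightarrow> P (p + q)"
    and single: "\<And>k c. P (Poly_Mapping.single k c)"
  shows "P (p :: 'm \<Rightarrow>\<^sub>0 'k::comm_monoid_add)"
proof (induction p rule: Poly_Mapping.update_induct)
  case const
  show ?case using single[of undefined 0] by simp
next
  case (update f a b)
  have "Poly_Mapping.update a b f = f + Poly_Mapping.single a b"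
    using update(1) by (intro poly_mapping_eqI)
      (auto simp: lookup_update lookup_add lookup_single in_keys_iff when_def)
  then show ?case using add[OF update(3) single] by simp
qed

text \<open>Coefficients travel along \<open>h\<close> and monomials along \<open>\<mu>\<close>, so
  that substitution, evaluation of Laurent polynomials and specialization of a coaction are
  instances of one construction.\<close>

definition linear_extension :: "('k::zero \<Rightarrow> 'r::ring_1) \<Rightarrow> ('m \<Rightarrow> 'r) \<Rightarrow> ('m \<Rightarrow>\<^sub>0 'k) \<Rightarrow> 'r" where
  "linear_extension h \<mu> p = (\<Sum>m\<in>Poly_Mapping.keys p. h (Poly_Mapping.lookup p m) * \<mu> m)"

lemma linear_extension_superset:
  assumes "h 0 = 0" "finite S" "Poly_Mapping.keys p \<subseteq> S"
  shows "linear_extension h \<mu> p = (\<Sum>m\<in>S. h (Poly_Mapping.lookup p m) * \<mu> m)"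
  unfolding linear_extension_def using assms
  by (intro sum.mono_neutral_left) (auto simp: in_keys_iff)

lemma linear_extension_single:
  "h 0 = 0 \<Longrightarrow> linear_extension h \<mu> (Poly_Mapping.single m c) = h c * \<mu> m"
  by (cases "c = 0") (auto simp: linear_extension_def)

lemma linear_extension_add:
  fixes h :: "'k::comm_monoid_add \<Rightarrow> 'r::ring_1"
  assumes h: "h 0 = 0" "\<And>c d. h (c + d) = h c + h d"
  shows "linear_extension h \<mu> (p + q) = linear_extension h \<mu> p + linear_extension h \<mu> q"
proof -
  let ?S = "Poly_Mapping.keys p \<union> Poly_Mapping.keys q"
  have S: "finite ?S" "Poly_Mapping.keys p \<subseteq> ?S" "Poly_Mapping.keys q \<subseteq> ?S"
    "Poly_Mapping.keys (p + q) \<subseteq> ?S"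
    using keys_add[of p q] by auto
  show ?thesis
    by (simp add: linear_extension_superset[where h = h, OF h(1) S(1)] S lookup_add h(2) distrib_right
        sum.distrib)
qed

text \<open>Both sides are additive in each factor, which leaves two monomials. There
  \<open>h d\<close> has to pass \<open>\<mu> m\<close>, hence the commutation hypothesis.\<close>

lemma linear_extension_mult:
  fixes h :: "'k::semiring_0 \<Rightarrow> 'r::ring_1" and \<mu> :: "'m::monoid_add \<Rightarrow> 'r"
  assumes h: "h 0 = 0" "\<And>c d. h (c + d) = h c + h d" "\<And>c d. h (c * d) = h c * h d"
    and \<mu>: "\<And>m n. \<mu> (m + n) = \<mu> m * \<mu> n"
    and commute: "\<And>c m. h c * \<mu> m = \<mu> m * h c"
  shows "linear_extension h \<mu> (p * q) = linear_extension h \<mu> p * linear_extension h \<mu> q"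
proof (induction p rule: poly_mapping_add_induct)
  case (add p p')
  then show ?case by (simp add: distrib_right linear_extension_add h)
next
  case (single m c)
  show ?case
  proof (induction q rule: poly_mapping_add_induct)
    case (add q q')
    then show ?case by (simp add: distrib_left linear_extension_add h)
  next
    case (single n d)
    have "h (c * d) * \<mu> (m + n) = h c * (h d * \<mu> m) * \<mu> n"
      by (simp add: h(3) \<mu> mult.assoc)
    also have "\<dots> = h c * \<mu> m * (h d * \<mu> n)"
      by (simp add: commute[of d m] mult.assoc)
    finally show ?case by (simp add: mult_single linear_extension_single h(1))
  qed
qed

lemma const_0 [simp]: "const 0 = 0"
  by (simp add: const_def)

lemma const_1 [simp]: "const 1 = 1"
  by (simp add: const_def)

lemma const_add: "const (c + d) = const c + (const d :: 'm::zero \<Rightarrow>\<^sub>0 'k::monoid_add)"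
  by (simp add: const_def single_add)

lemma const_mult: "const (c * d) = const c * (const d :: 'm::monoid_add \<Rightarrow>\<^sub>0 'k::semiring_0)"
  by (simp add: const_def mult_single)

lemma const_mult_single:
  "const c * Poly_Mapping.single m d = Poly_Mapping.single (m :: 'm::monoid_add) (c * d :: 'k::semiring_0)"
  by (simp add: const_def mult_single)

lemma lookup_const_mult [simp]:
  "Poly_Mapping.lookup (const c * (p :: 'm::monoid_add \<Rightarrow>\<^sub>0 'k::semiring_0)) m = c * Poly_Mapping.lookup p m"
proof (induction p rule: poly_mapping_add_induct)
  case (add p q)
  then show ?case by (simp add: distrib_left lookup_add)
next
  case (single k d)
  then show ?case by (simp add: const_mult_single lookup_single when_def)
qed

lemma const_commute:
  fixes p :: "'m::monoid_add \<Rightarrow>\<^sub>0 'k::comm_semiring_0"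
  shows "const c * p = p * const c"
proof (induction p rule: poly_mapping_add_induct)
  case (add p q)
  then show ?case by (simp add: distrib_left distrib_right)
next
  case (single k d)
  then show ?case by (simp add: const_def mult_single mult.commute)
qed

section \<open>Homomorphisms of free algebras\<close>

lemma single_Word_Cons:
  "Poly_Mapping.single (Word (i # w)) 1 = gen i * Poly_Mapping.single (Word w) (1 :: 'k::semiring_1)"
  by (simp add: gen_def mult_single)

lemma word_eval_0 [simp]: "word_eval g 0 = 1"
  by (simp add: zero_free_word_def)

lemma word_eval_gen: "word_eval gen w = Poly_Mapping.single w (1 :: 'k::field)"
proof (cases w)
  case (Word v)
  have "word_eval gen (Word v) = Poly_Mapping.single (Word v) (1 :: 'k)"
  proof (induction v)
    case Nil
    show ?case by (metis single_one word_eval_0 zero_free_word_def)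
  qed (simp add: single_Word_Cons)
  then show ?thesis by (simp add: Word)
qed

lemma word_eval_add: "word_eval g (v + w) = word_eval g v * word_eval g w"
  by (cases v; cases w) simp

lemma alg_hom_subst: "alg_hom const const (subst g)"
proof -
  have eq: "subst g = linear_extension const (word_eval g)"
    by (simp add: fun_eq_iff subst_def linear_extension_def)
  have "linear_extension const (word_eval g) (const c) = const c" for c
    using linear_extension_single[where h = const and \<mu> = "word_eval g" and m = 0 and c = c]
    by (simp flip: const_def)
  moreover have "linear_extension const (word_eval g) (x * y) =
      linear_extension const (word_eval g) x * linear_extension const (word_eval g) y" for x y
    by (rule linear_extension_mult)
      (simp_all add: const_add const_mult word_eval_add const_commute[of _ "word_eval g _"])
  ultimately show ?thesis
    by (simp add: eq alg_hom_def linear_extension_add const_add)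
qed

context
  fixes \<phi> :: "('n, 'k::field) free_algebra \<Rightarrow> ('n, 'k) free_algebra"
  assumes \<phi>: "alg_hom const const \<phi>"
begin

lemma hom_add: "\<phi> (f + g) = \<phi> f + \<phi> g"
  and hom_mult: "\<phi> (f * g) = \<phi> f * \<phi> g"
  and hom_const: "\<phi> (const c) = const c"
  using \<phi> by (auto simp: alg_hom_def)

lemma hom_0: "\<phi> 0 = 0" and hom_1: "\<phi> 1 = 1"
  using hom_const[of 0] hom_const[of 1] by auto

lemma hom_diff: "\<phi> (f - g) = \<phi> f - \<phi> g"
  using hom_add[of "f - g" g] by (simp add: algebra_simps)

lemma hom_sum: "\<phi> (\<Sum>x\<in>A. f x) = (\<Sum>x\<in>A. \<phi> (f x))"
  by (induction A rule: infinite_finite_induct) (auto simp: hom_0 hom_add)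

lemma hom_scale: "\<phi> (const c * f) = const c * \<phi> f"
  by (simp add: hom_mult hom_const)

lemma hom_word: "\<phi> (Poly_Mapping.single (Word w) 1) = word_eval (\<phi> \<circ> gen) (Word w)"
proof (induction w)
  case Nil
  then show ?case using hom_1 by (simp flip: zero_free_word_def)
next
  case (Cons i w)
  then show ?case by (simp add: single_Word_Cons hom_mult)
qed

lemma hom_single:
  "\<phi> (Poly_Mapping.single (Word w) c) = const c * word_eval (\<phi> \<circ> gen) (Word w)"
  using hom_scale[of c "Poly_Mapping.single (Word w) 1"] by (simp add: const_mult_single hom_word)

text \<open>The universal property of the free algebra; it lets homomorphisms be compared on
  generators.\<close>

lemma hom_eq_subst: "\<phi> f = subst (\<phi> \<circ> gen) f"
proof (induction f rule: poly_mapping_add_induct)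
  case (add p q)
  have "subst (\<phi> \<circ> gen) (p + q) = subst (\<phi> \<circ> gen) p + subst (\<phi> \<circ> gen) q"
    using alg_hom_subst[of "\<phi> \<circ> gen"] by (simp only: alg_hom_def)
  with add show ?case by (simp only: hom_add)
next
  case (single w c)
  then show ?case by (cases w) (simp only: hom_single, simp add: subst_def comp_def)
qed

end

lemma alg_hom_comp:
  "alg_hom \<iota> \<kappa> h \<Longrightarrow> alg_hom \<kappa> \<mu> g \<Longrightarrow> alg_hom \<iota> \<mu> (g \<circ> h)"
  by (simp add: alg_hom_def)

lemma alg_hom_id: "alg_hom \<iota> \<iota> id"
  by (simp add: alg_hom_def)

lemma alg_hom_eqI:
  fixes \<phi> \<psi> :: "('n, 'k::field) free_algebra \<Rightarrow> ('n, 'k) free_algebra"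
  assumes "alg_hom const const \<phi>" "alg_hom const const \<psi>" "\<And>i. \<phi> (gen i) = \<psi> (gen i)"
  shows "\<phi> = \<psi>"
proof -
  have eq: "\<phi> \<circ> gen = \<psi> \<circ> gen" using assms(3) by (simp add: fun_eq_iff)
  show ?thesis
  proof
    fix f show "\<phi> f = \<psi> f"
      unfolding hom_eq_subst[OF assms(1), of f] hom_eq_subst[OF assms(2), of f] eq ..
  qed
qed

lemma subst_gen_eq [simp]: "subst g (gen i) = g i"
  by (simp add: subst_def gen_def)

lemma subst_gen: "subst gen = id"
  by (rule alg_hom_eqI) (auto simp: alg_hom_subst alg_hom_id)

section \<open>The adic filtration\<close>

primrec word_length :: "'n free_word \<Rightarrow> nat" where
  "word_length (Word w) = length w"

lemma word_length_add [simp]: "word_length (v + w) = word_length v + word_length w"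
  by (cases v; cases w) simp

lemma word_length_eq_0_iff [simp]: "word_length w = 0 \<longleftrightarrow> w = 0"
  by (cases w) (simp add: zero_free_word_def)

text \<open>The \<open>N\<close>-th power of the augmentation ideal.\<close>

definition aug_power :: "nat \<Rightarrow> ('n, 'k::field) free_algebra set" where
  "aug_power N = {f. \<forall>w. word_length w < N \<longrightarrow> Poly_Mapping.lookup f w = 0}"

lemma aug_power_0 [simp]: "aug_power 0 = UNIV"
  by (simp add: aug_power_def)

lemma aug_power_1: "f \<in> aug_power (Suc 0) \<longleftrightarrow> const_term f = 0"
  by (auto simp: aug_power_def const_term_def)

lemma aug_power_mono: "f \<in> aug_power N \<Longrightarrow> M \<le> N \<Longrightarrow> f \<in> aug_power M"
  by (auto simp: aug_power_def)

lemma zero_in_aug_power [simp]: "0 \<in> aug_power N"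
  by (simp add: aug_power_def)

lemma aug_power_add: "f \<in> aug_power N \<Longrightarrow> g \<in> aug_power N \<Longrightarrow> f + g \<in> aug_power N"
  by (simp add: aug_power_def lookup_add)

lemma aug_power_diff: "f \<in> aug_power N \<Longrightarrow> g \<in> aug_power N \<Longrightarrow> f - g \<in> aug_power N"
  by (simp add: aug_power_def lookup_minus)

lemma aug_power_scale: "f \<in> aug_power N \<Longrightarrow> const c * f \<in> aug_power N"
  by (simp add: aug_power_def)

lemma aug_power_sum: "(\<And>x. x \<in> A \<Longrightarrow> f x \<in> aug_power N) \<Longrightarrow> (\<Sum>x\<in>A. f x) \<in> aug_power N"
  by (induction A rule: infinite_finite_induct) (auto simp: aug_power_add)

lemma aug_power_mult:
  assumes "f \<in> aug_power N" "g \<in> aug_power M"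
  shows "f * g \<in> aug_power (N + M)"
proof -
  have "Poly_Mapping.lookup (f * g) w = 0" if w: "word_length w < N + M" for w
  proof (rule ccontr)
    assume "Poly_Mapping.lookup (f * g) w \<noteq> 0"
    then obtain u v where uv: "w = u + v" "u \<in> Poly_Mapping.keys f" "v \<in> Poly_Mapping.keys g"
      using keys_mult[of f g] by (force simp: in_keys_iff)
    then have "N \<le> word_length u" "M \<le> word_length v"
      using assms by (auto simp: aug_power_def in_keys_iff not_le[symmetric])
    then show False using w uv(1) by simp
  qed
  then show ?thesis by (simp add: aug_power_def)
qed

lemma aug_power_word_eval:
  "(\<And>i. g i \<in> aug_power (Suc 0)) \<Longrightarrow> word_eval g w \<in> aug_power (word_length w)"
proof (induction w)
  case (Word w)
  then show ?case
  proof (induction w)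
    case (Cons i w)
    then show ?case using aug_power_mult[of "g i" "Suc 0" "word_eval g (Word w)"] by simp
  qed simp
qed

text \<open>Generators are sent into the augmentation ideal I, so a word of length l is sent into
  the l-th power of I.\<close>

lemma aug_power_hom:
  fixes \<phi> :: "('n, 'k::field) free_algebra \<Rightarrow> ('n, 'k) free_algebra"
  assumes "alg_hom const const \<phi>" "\<And>i. const_term (\<phi> (gen i)) = 0" "f \<in> aug_power N"
  shows "\<phi> f \<in> aug_power N"
proof -
  have "subst (\<phi> \<circ> gen) f \<in> aug_power N"
    unfolding subst_def
  proof (intro aug_power_sum aug_power_scale)
    fix w assume "w \<in> Poly_Mapping.keys f"
    then have "N \<le> word_length w"
      using assms(3) by (auto simp: aug_power_def in_keys_iff not_le[symmetric])
    then show "word_eval (\<phi> \<circ> gen) w \<in> aug_power N"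
      using aug_power_word_eval[of "\<phi> \<circ> gen" w] assms(2)
      by (auto simp: aug_power_1 intro: aug_power_mono)
  qed
  then show ?thesis by (simp add: hom_eq_subst[OF assms(1), symmetric])
qed

lemma aug_power_Inter: "(\<And>N. f \<in> aug_power N) \<Longrightarrow> f = 0"
  by (rule poly_mapping_eqI) (use lessI in \<open>fastforce simp: aug_power_def\<close>)

section \<open>Linear parts of elements and endomorphisms\<close>

definition linear_coeffs :: "('n, 'k::field) free_algebra \<Rightarrow> 'k ^ 'n" where
  "linear_coeffs f = (\<chi> j. Poly_Mapping.lookup f (Word [j]))"

lemma linear_coeffs_add: "linear_coeffs (f + g) = linear_coeffs f + linear_coeffs g"
  by (simp add: linear_coeffs_def vec_eq_iff lookup_add)

lemma linear_coeffs_diff: "linear_coeffs (f - g) = linear_coeffs f - linear_coeffs g"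
  by (simp add: linear_coeffs_def vec_eq_iff lookup_minus)

lemma linear_coeffs_scale: "linear_coeffs (const c * f) = c *s linear_coeffs f"
  by (simp add: linear_coeffs_def vec_eq_iff)

lemma linear_coeffs_gen: "linear_coeffs (gen i) = axis i 1"
  by (simp add: linear_coeffs_def vec_eq_iff gen_def lookup_single when_def axis_def)

lemma linear_coeffs_sum: "linear_coeffs (\<Sum>x\<in>A. f x) = (\<Sum>x\<in>A. linear_coeffs (f x))"
  by (simp add: linear_coeffs_def vec_eq_iff lookup_sum)

lemma aug_power_2:
  "f \<in> aug_power 2 \<longleftrightarrow> const_term f = 0 \<and> linear_coeffs f = 0"
proof
  assume f: "const_term f = 0 \<and> linear_coeffs f = 0"
  have "Poly_Mapping.lookup f w = 0" if "word_length w < 2" for w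
  proof (cases w)
    case (Word v)
    then consider "v = []" | i where "v = [i]"
      using \<open>word_length w < 2\<close> by (cases v; cases "tl v") auto
    then show ?thesis
      using f Word by cases (auto simp: const_term_def linear_coeffs_def vec_eq_iff zero_free_word_def)
  qed
  then show "f \<in> aug_power 2" by (simp add: aug_power_def)
next
  assume "f \<in> aug_power 2"
  then show "const_term f = 0 \<and> linear_coeffs f = 0"
    by (auto simp: aug_power_def const_term_def linear_coeffs_def vec_eq_iff)
      (metis word_length_eq_0_iff zero_less_numeral)
qed

lemma linear_part_gen: "linear_part \<phi> $ j $ i = linear_coeffs (\<phi> (gen i)) $ j"
  by (simp add: linear_part_def linear_coeffs_def)

text \<open>This is the induced action on I/I^2. Constants remain constants and words of length at
  least two stay in I^2, so only generators contribute.\<close>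

lemma linear_coeffs_hom:
  fixes \<phi> :: "('n::finite, 'k::field) free_algebra \<Rightarrow> ('n, 'k) free_algebra"
  assumes \<phi>: "alg_hom const const \<phi>" "\<And>i. const_term (\<phi> (gen i)) = 0"
  shows "linear_coeffs (\<phi> f) = linear_part \<phi> *v linear_coeffs f"
proof (induction f rule: poly_mapping_add_induct)
  case (add p q)
  then show ?case by (simp add: hom_add[OF \<phi>(1)] linear_coeffs_add matrix_vector_right_distrib)
next
  case (single u c)
  obtain w where u: "u = Word w" by (cases u)
  consider "w = []" | i where "w = [i]" | "length w \<ge> 2"
    by (cases w; cases "tl w") auto
  then show ?case
  proof cases
    case 1
    then show ?thesis
      by (simp add: u hom_single[OF \<phi>(1)] vec_eq_iff matrix_vector_mult_def linear_coeffs_def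
          const_def lookup_single zero_free_word_def)
  next
    case 2
    then have s: "Poly_Mapping.single u c = const c * gen i"
      by (simp add: gen_def const_mult_single u)
    show ?thesis
      unfolding s hom_scale[OF \<phi>(1)]
      by (simp add: linear_coeffs_scale linear_coeffs_gen vec_eq_iff matrix_vector_mult_def
          axis_def if_distrib linear_part_gen sum.delta mult.commute cong: if_cong)
  next
    case 3
    then have "Poly_Mapping.single u c \<in> aug_power 2"
      by (auto simp: aug_power_def lookup_single when_def u)
    then show ?thesis
      using aug_power_hom[OF \<phi>, of "Poly_Mapping.single u c" 2] by (simp add: aug_power_2)
  qed
qed

text \<open>An endomorphism tangent to the identity acts trivially on the associated graded algebra.\<close>

context
  fixes \<psi> :: "('n, 'k::field) free_algebra \<Rightarrow> ('n, 'k) free_algebra"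
  assumes \<psi>: "alg_hom const const \<psi>" and tangent: "\<And>i. \<psi> (gen i) - gen i \<in> aug_power 2"
begin

lemma tangent_word: "word_eval (\<psi> \<circ> gen) w - Poly_Mapping.single w 1 \<in> aug_power (Suc (word_length w))"
proof (induction w)
  case (Word w)
  show ?case
  proof (induction w)
    case Nil
    then show ?case by (simp flip: zero_free_word_def)
  next
    case (Cons i w)
    let ?W = "word_eval (\<psi> \<circ> gen) (Word w)" and ?w = "Poly_Mapping.single (Word w) (1::'k)"
    have gen1: "gen j \<in> aug_power (Suc 0)" for j :: 'n
      by (simp add: aug_power_1 const_term_def gen_def lookup_single zero_free_word_def)
    have psi1: "(\<psi> \<circ> gen) j \<in> aug_power (Suc 0)" for j
      using aug_power_add[OF aug_power_mono[OF tangent[of j], of "Suc 0"] gen1[of j]] by simp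
    \<comment> \<open>Telescoping: the difference for the longer word is the sum of this product and
      \<open>gen i * (?W - ?w)\<close>. In each, one factor exceeds its expected order by
      one.\<close>
    have "(\<psi> (gen i) - gen i) * ?W \<in> aug_power (2 + length w)"
      using aug_power_mult[OF tangent[of i] aug_power_word_eval[of "\<psi> \<circ> gen" "Word w"]] psi1 by simp
    moreover have "gen i * (?W - ?w) \<in> aug_power (Suc 0 + Suc (word_length (Word w)))"
      by (rule aug_power_mult[OF gen1 Cons])
    ultimately have "(\<psi> (gen i) - gen i) * ?W + gen i * (?W - ?w) \<in> aug_power (Suc (Suc (length w)))"
      by (simp add: aug_power_add)
    then show ?case by (simp add: single_Word_Cons algebra_simps comp_def)
  qed
qed

lemma tangent_aug_power:
  assumes "f \<in> aug_power N"
  shows "\<psi> f - f \<in> aug_power (Suc N)"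
proof -
  have "f = subst gen f" by (simp add: subst_gen)
  also have "\<dots> = (\<Sum>w\<in>Poly_Mapping.keys f. const (Poly_Mapping.lookup f w) * Poly_Mapping.single w 1)"
    by (simp add: subst_def word_eval_gen)
  finally have "\<psi> f - f = (\<Sum>w\<in>Poly_Mapping.keys f. const (Poly_Mapping.lookup f w) *
      (word_eval (\<psi> \<circ> gen) w - Poly_Mapping.single w 1))"
    by (simp add: hom_eq_subst[OF \<psi>, of f] subst_def sum_subtractf right_diff_distrib)
  moreover have "word_eval (\<psi> \<circ> gen) w - Poly_Mapping.single w 1 \<in> aug_power (Suc N)"
    if "w \<in> Poly_Mapping.keys f" for w
  proof -
    have "N \<le> word_length w"
      using assms that by (auto simp: aug_power_def in_keys_iff not_le[symmetric])
    then show ?thesis using aug_power_mono[OF tangent_word[of w]] by simp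
  qed
  ultimately show ?thesis by (simp add: aug_power_sum aug_power_scale)
qed

text \<open>If \<open>f\<close> is known to have order \<open>N\<close>, then \<open>f\<close>
  differs from \<open>\<psi> f\<close> only in order \<open>N + 1\<close>, so the order of
  \<open>\<psi> f\<close> bounds that of \<open>f\<close> one step further.\<close>

lemma tangent_reflects_aug_power: "\<psi> f \<in> aug_power N \<Longrightarrow> f \<in> aug_power N"
proof (induction N)
  case (Suc N)
  then have "f \<in> aug_power N" using aug_power_mono[OF Suc.prems, of N] by simp
  then show ?case using aug_power_diff[OF Suc.prems tangent_aug_power[of f N]] by simp
qed simp

lemma tangent_approx: "\<exists>p. f - \<psi> p \<in> aug_power N"
proof (induction N)
  case (Suc N)
  then obtain p where p: "f - \<psi> p \<in> aug_power N" by blast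
  \<comment> \<open>Correcting \<open>p\<close> by its own error e leaves the error e - \<psi> e,
    which has one order more.\<close>
  have "f - \<psi> (p + (f - \<psi> p)) = 0 - (\<psi> (f - \<psi> p) - (f - \<psi> p))"
    by (simp add: hom_add[OF \<psi>])
  then show ?case using aug_power_diff[OF zero_in_aug_power tangent_aug_power[OF p]] by metis
qed simp

end

text \<open>The linear substitution \<alpha> given by the inverse matrix makes
  \<open>\<alpha> \<circ> \<beta>\<close> and \<open>\<beta> \<circ> \<alpha>\<close> tangent to the
  identity. The first composite gives strictness of the filtration, the second gives density of the
  image.\<close>

lemma filtered_iso_of_invertible_linear_part:
  fixes \<beta> :: "('n::finite, 'k::field) free_algebra \<Rightarrow> ('n, 'k) free_algebra"
  assumes \<beta>: "alg_hom const const \<beta>" "\<And>i. const_term (\<beta> (gen i)) = 0"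
    and inv: "invertible (linear_part \<beta>)"
  shows "\<And>f N. \<beta> f \<in> aug_power N \<Longrightarrow> f \<in> aug_power N"
    and "\<And>f N. \<exists>p. f - \<beta> p \<in> aug_power N"
proof -
  obtain B where B: "linear_part \<beta> ** B = mat 1" "B ** linear_part \<beta> = mat 1"
    using inv by (auto simp: invertible_def)
  define \<alpha> :: "('n, 'k) free_algebra \<Rightarrow> ('n, 'k) free_algebra"
    where "\<alpha> = subst (\<lambda>i. \<Sum>j\<in>UNIV. const (B $ j $ i) * gen j)"
  have \<alpha>: "alg_hom const const \<alpha>" by (simp add: \<alpha>_def alg_hom_subst)
  have \<alpha>0: "const_term (\<alpha> (gen i)) = 0" for i
    by (simp add: \<alpha>_def const_term_def lookup_sum)
      (simp add: gen_def lookup_single zero_free_word_def)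
  have \<alpha>L: "linear_part \<alpha> = B"
    by (simp add: vec_eq_iff linear_part_gen \<alpha>_def linear_coeffs_sum linear_coeffs_scale
        linear_coeffs_gen axis_def if_distrib sum.delta cong: if_cong)
  \<comment> \<open>Stated for a general pair because both orders of composition are needed.\<close>
  have tangent: "\<phi> (\<psi> (gen i)) - gen i \<in> aug_power 2"
    if \<phi>: "alg_hom const const \<phi>" "\<And>i. const_term (\<phi> (gen i)) = 0"
      and \<psi>: "\<And>i. const_term (\<psi> (gen i)) = 0"
      and L: "linear_part \<phi> ** linear_part \<psi> = mat 1"
    for \<phi> \<psi> :: "('n, 'k) free_algebra \<Rightarrow> ('n, 'k) free_algebra" and i
  proof -
    have "const_term (\<phi> (\<psi> (gen i))) = 0"
      using aug_power_hom[OF \<phi>, of "\<psi> (gen i)" "Suc 0"] by (simp add: aug_power_1 \<psi>)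
    moreover have "const_term (gen i :: ('n, 'k) free_algebra) = 0"
      by (simp add: const_term_def gen_def lookup_single zero_free_word_def)
    moreover have "linear_coeffs (\<phi> (\<psi> (gen i))) = axis i 1"
    proof -
      have "linear_coeffs (\<psi> (gen i)) = linear_part \<psi> *v axis i 1"
        by (simp add: vec_eq_iff matrix_vector_mult_def axis_def if_distrib linear_part_gen
            sum.delta cong: if_cong)
      then show ?thesis
        by (simp add: linear_coeffs_hom[OF \<phi>] matrix_vector_mul_assoc L)
    qed
    ultimately show ?thesis
      by (simp add: aug_power_2 linear_coeffs_diff linear_coeffs_gen)
        (simp add: const_term_def lookup_minus)
  qed
  have \<alpha>\<beta>: "(\<alpha> \<circ> \<beta>) (gen i) - gen i \<in> aug_power 2" for i
    using tangent[OF \<alpha> \<alpha>0, of \<beta> i] by (simp add: \<beta> \<alpha>L B)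
  have \<beta>\<alpha>: "(\<beta> \<circ> \<alpha>) (gen i) - gen i \<in> aug_power 2" for i
    using tangent[OF \<beta>, of \<alpha> i] by (simp add: \<alpha>0 \<alpha>L B)
  show "f \<in> aug_power N" if "\<beta> f \<in> aug_power N" for f N
    using tangent_reflects_aug_power[OF alg_hom_comp[OF \<beta>(1) \<alpha>] \<alpha>\<beta>, of f N]
      aug_power_hom[OF \<alpha> \<alpha>0 that] by simp
  show "\<exists>p. f - \<beta> p \<in> aug_power N" for f N
    using tangent_approx[OF alg_hom_comp[OF \<alpha> \<beta>(1)] \<beta>\<alpha>, of f N] by auto
qed

section \<open>Characters of the torus\<close>

text \<open>In a finite field, adding 1 to the product of all X - a gives a nonconstant polynomial
  without roots.\<close>

lemma infinite_UNIV_alg_closed: "infinite (UNIV :: 'k::alg_closed_field set)"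
proof
  assume fin: "finite (UNIV :: 'k set)"
  define p :: "'k poly" where "p = (\<Prod>a\<in>UNIV. [:- a, 1:]) + 1"
  have "poly p x = 1" for x
    using fin by (auto simp: p_def poly_prod)
  moreover have "\<exists>x. poly p x = 0"
  proof (rule alg_closed_imp_poly_has_root)
    have "degree (\<Prod>a\<in>UNIV. [:- a, 1:] :: 'k poly) = card (UNIV :: 'k set)"
      by (subst degree_prod_eq_sum_degree) auto
    moreover have "card (UNIV :: 'k set) > 0"
      using fin by (simp add: card_gt_0_iff)
    ultimately show "degree p > 0"
      unfolding p_def by (subst degree_add_eq_left) auto
  qed
  ultimately show False by simp
qed

lemma finite_roots_of_unity_field:
  fixes d :: nat
  assumes "d > 0"
  shows "finite {s :: 'k::field. s ^ d = 1}"
proof -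
  have "monom 1 d - 1 \<noteq> (0 :: 'k poly)"
    using assms by (auto simp: poly_eq_iff coeff_monom dest!: spec[of _ d])
  from poly_roots_finite[OF this] show ?thesis by (simp add: poly_monom)
qed

text \<open>Dividing the two powers shows that \<open>s\<close> is a root of unity of order dividing
  the difference of the exponents.\<close>

lemma finite_power_int_eq:
  assumes "m \<noteq> m'"
  shows "finite {s :: 'k::field. s \<noteq> 0 \<and> s powi m = s powi m'}"
proof -
  have "s ^ nat \<bar>m - m'\<bar> = 1" if "s \<noteq> 0" "s powi m = s powi m'" for s :: 'k
  proof -
    have "s powi (m - m') = 1" "s powi (m' - m) = 1"
      using that by (simp_all add: power_int_diff)
    then show ?thesis
      by (cases "m \<ge> m'") (simp_all add: power_int_def split: if_splits)
  qed
  then have "{s :: 'k. s \<noteq> 0 \<and> s powi m = s powi m'} \<subseteq> {s. s ^ nat \<bar>m - m'\<bar> = 1}"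
    by blast
  then show ?thesis
    using finite_roots_of_unity_field[of "nat \<bar>m - m'\<bar>"] assms by (auto intro: finite_subset)
qed

text \<open>The index \<open>j\<close> may vary with \<open>s\<close>. If \<open>m\<close> differed
  from every \<open>e j\<close>, the infinite set of nonzero scalars would be a finite union of
  finite sets.\<close>

lemma power_int_exponent_in:
  fixes m :: int
  assumes "finite J" and eq: "\<And>s :: 'k::alg_closed_field. s \<noteq> 0 \<Longrightarrow> \<exists>j\<in>J. s powi m = s powi e j"
  shows "\<exists>j\<in>J. m = e j"
proof (rule ccontr)
  assume "\<not> ?thesis"
  then have "finite (\<Union>j\<in>J. {s :: 'k. s \<noteq> 0 \<and> s powi m = s powi e j})"
    using assms(1) finite_power_int_eq by blast
  moreover have "UNIV - {0 :: 'k} \<subseteq> (\<Union>j\<in>J. {s :: 'k. s \<noteq> 0 \<and> s powi m = s powi e j})"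
    using eq by blast
  ultimately have "finite (UNIV - {0 :: 'k})" by (rule finite_subset[rotated])
  then show False by (simp add: infinite_UNIV_alg_closed)
qed

section \<open>Separation and independence of characters\<close>

lemma character_0 [simp]: "character 0 t = 1"
  by (simp add: character_def)

lemma character_1 [simp]: "character a 1 = 1"
  by (simp add: character_def)

lemma character_add: "t \<in> torus \<Longrightarrow> character (a + b) t = character a t * character b t"
  by (simp add: character_def torus_def power_int_add prod.distrib)

lemma character_mult: "character a (s * t) = character a s * character a t"
  by (simp add: character_def power_int_mult_distrib prod.distrib)

lemma torus_mult: "s \<in> torus \<Longrightarrow> t \<in> torus \<Longrightarrow> s * t \<in> torus"
  by (simp add: torus_def)

text \<open>A point whose coordinates are 1 except at one index where the exponents differ reduces
  the claim to powers of a single scalar.\<close>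

lemma characters_separated:
  fixes a b :: "int ^ 'r::finite"
  assumes "a \<noteq> b"
  obtains t :: "'k::alg_closed_field ^ 'r" where "t \<in> torus" "character a t \<noteq> character b t"
proof -
  obtain j where j: "a $ j \<noteq> b $ j" using assms by (auto simp: vec_eq_iff)
  then obtain s :: 'k where s: "s \<noteq> 0" "s powi (a $ j) \<noteq> s powi (b $ j)"
    using power_int_exponent_in[of "{()}" "a $ j" "\<lambda>_. b $ j"] by auto
  define t :: "'k ^ 'r" where "t = (\<chi> i. if i = j then s else 1)"
  have "character c t = s powi (c $ j)" for c
  proof -
    have "character c t = (\<Prod>i\<in>UNIV. if i = j then s powi (c $ j) else 1)"
      unfolding character_def by (intro prod.cong) (auto simp: t_def)
    then show ?thesis by simp
  qed
  moreover have "t \<in> torus" using s by (simp add: t_def torus_def)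
  ultimately show ?thesis using that s by auto
qed

text \<open>Dedekind's argument: replacing \<open>t\<close> by \<open>s t\<close> in a relation eliminates one of its terms.\<close>

lemma characters_independent:
  fixes c :: "int ^ 'r::finite \<Rightarrow> 'k::alg_closed_field"
  assumes "finite A" and "\<And>t :: 'k ^ 'r. t \<in> torus \<Longrightarrow> (\<Sum>a\<in>A. c a * character a t) = 0"
    and "a \<in> A"
  shows "c a = 0"
  using assms
proof (induction A arbitrary: c a rule: finite_induct)
  case (insert b A)
  have A0: "c a = 0" if a: "a \<in> A" for a
  proof -
    have "a \<noteq> b" using a insert.hyps by auto
    then obtain s :: "'k ^ 'r" where s: "s \<in> torus" "character a s \<noteq> character b s"
      by (rule characters_separated)
    \<comment> \<open>Subtracting \<open>character b s\<close> times the relation at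
      \<open>t\<close> from the relation at \<open>s * t\<close> cancels the term of
      \<open>b\<close>, and the induction hypothesis applies to the new coefficients.\<close>
    have "c a * (character a s - character b s) = 0"
    proof (rule insert.IH[OF _ a])
      fix t :: "'k ^ 'r" assume t: "t \<in> torus"
      have "c b * character b t = - (\<Sum>a\<in>A. c a * character a t)"
        "c b * character b (s * t) = - (\<Sum>a\<in>A. c a * character a (s * t))"
        using insert.prems(1)[OF t] insert.prems(1)[OF torus_mult[OF s(1) t]] insert.hyps
        by (simp_all add: eq_neg_iff_add_eq_0)
      then have "(\<Sum>a\<in>A. c a * character a (s * t)) = character b s * (\<Sum>a\<in>A. c a * character a t)"
        by (metis (no_types, lifting) character_mult mult.left_commute mult_minus_right
            neg_equal_iff_equal)
      then show "(\<Sum>a\<in>A. c a * (character a s - character b s) * character a t) = 0"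
        by (simp add: character_mult algebra_simps sum_subtractf sum_distrib_left)
    qed
    then show ?thesis using s by simp
  qed
  have "1 \<in> (torus :: ('k ^ 'r) set)" by (simp add: torus_def)
  from insert.prems(1)[OF this] have "c b = 0" using insert.hyps A0 by simp
  then show ?case using A0 insert.prems(2) by auto
qed simp

section \<open>Weight vectors\<close>

primrec word_weight :: "('n \<Rightarrow> int) \<Rightarrow> 'n free_word \<Rightarrow> int" where
  "word_weight d (Word w) = sum_list (map d w)"

lemma word_weight_ge_length:
  assumes "\<And>i. 0 < d i"
  shows "int (word_length w) \<le> word_weight d w"
proof (cases w)
  case (Word v)
  have "int (length v) \<le> sum_list (map d v)"
    using assms by (induction v) (auto simp: Ball_def intro: add_mono, smt (verit))
  then show ?thesis by (simp add: Word)
qed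

lemma lookup_diagonal:
  fixes s :: "'k::field" and d :: "'n \<Rightarrow> int"
  assumes "s \<noteq> 0"
  shows "Poly_Mapping.lookup (subst (\<lambda>i. const (s powi d i) * gen i) p) w =
    s powi word_weight d w * Poly_Mapping.lookup p w"
proof (induction p rule: poly_mapping_add_induct)
  case (add p q)
  then show ?case by (simp add: hom_add[OF alg_hom_subst] lookup_add distrib_left)
next
  case (single u c)
  have "word_eval (\<lambda>i. const (s powi d i) * gen i) (Word v) =
      Poly_Mapping.single (Word v) (s powi word_weight d (Word v))" for v
  proof (induction v)
    case Nil
    have "Word [] = (0 :: 'n free_word)" by (simp add: zero_free_word_def)
    moreover have "word_weight d (Word []) = 0" by simp
    ultimately show ?case by (simp del: word_eval.simps word_weight.simps)
  next
    case (Cons i v)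
    then show ?case
      using assms by (simp add: gen_def const_mult_single mult_single power_int_add)
  qed
  then have "subst (\<lambda>i. const (s powi d i) * gen i) (Poly_Mapping.single u c) =
      Poly_Mapping.single u (c * s powi word_weight d u)"
    by (cases u) (simp add: hom_single[OF alg_hom_subst] comp_def const_mult_single)
  then show ?case by (simp add: lookup_single when_def)
qed

text \<open>
  Modulo each power of the augmentation ideal, a vector of weight \<open>m\<close> is \<open>\<beta> p\<close> for some \<open>p\<close> all of
  whose words have weight \<open>m\<close>. As letters have positive weight, these words have length at most \<open>m\<close>,
  and therefore \<open>p\<close> does not depend on the power.
\<close>

lemma weight_vector_in_range:
  fixes \<beta> :: "('n::finite, 'k::alg_closed_field) free_algebra \<Rightarrow> ('n, 'k) free_algebra"
  assumes \<beta>: "alg_hom const const \<beta>" "\<And>i. const_term (\<beta> (gen i)) = 0"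
    "invertible (linear_part \<beta>)"
    and \<phi>: "\<And>s. s \<noteq> 0 \<Longrightarrow> alg_hom const const (\<phi> s)"
      "\<And>s i. s \<noteq> 0 \<Longrightarrow> const_term (\<phi> s (gen i)) = 0"
    and weights: "\<And>s i. s \<noteq> 0 \<Longrightarrow> \<phi> s (\<beta> (gen i)) = const (s powi d i) * \<beta> (gen i)"
    and pos: "\<And>i. 0 < d i"
    and f: "\<And>s. s \<noteq> 0 \<Longrightarrow> \<phi> s f = const (s powi m) * f"
  shows "f \<in> range \<beta>"
proof -
  note reflect = filtered_iso_of_invertible_linear_part(1)[OF \<beta>]
  note approx = filtered_iso_of_invertible_linear_part(2)[OF \<beta>]
  \<comment> \<open>The absolute value only converts the weight to a natural number; words of weight
    \<open>m\<close> have length at most \<open>m\<close>.\<close>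
  define b where "b = nat \<bar>m\<bar>"
  \<comment> \<open>Both composites are homomorphisms and agree on generators: \<beta> intertwines
    the diagonal substitution with \<open>\<phi> s\<close>.\<close>
  have equivariant: "\<phi> s (\<beta> p) = \<beta> (subst (\<lambda>i. const (s powi d i) * gen i) p)" if s: "s \<noteq> 0" for s p
  proof -
    have "\<phi> s \<circ> \<beta> = \<beta> \<circ> subst (\<lambda>i. const (s powi d i) * gen i)"
      by (rule alg_hom_eqI[OF alg_hom_comp[OF \<beta>(1) \<phi>(1)[OF s]] alg_hom_comp[OF alg_hom_subst \<beta>(1)]])
        (simp add: hom_scale[OF \<beta>(1)] weights[OF s])
    then show ?thesis by (simp add: fun_eq_iff)
  qed
  \<comment> \<open>Applying multiplication by \<open>s powi m\<close> minus \<open>\<phi> s\<close>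
    to the error cancels \<open>f\<close>, which has weight \<open>m\<close>. What remains is an
    image under \<beta>, and strictness transfers its order to the preimage, where each word is
    scaled separately.\<close>
  have short: "word_length w \<le> b"
    if p: "f - \<beta> p \<in> aug_power N" and w: "word_length w < N" "Poly_Mapping.lookup p w \<noteq> 0" for p w N
  proof -
    have "s powi m = s powi word_weight d w" if s: "s \<noteq> 0" for s :: 'k
    proof -
      let ?\<delta> = "subst (\<lambda>i. const (s powi d i) * gen i)"
      have "const (s powi m) * (f - \<beta> p) - \<phi> s (f - \<beta> p) \<in> aug_power N"
        using aug_power_scale[OF p] aug_power_hom[OF \<phi>(1)[OF s] \<phi>(2)[OF s] p]
        by (rule aug_power_diff)
      also have "const (s powi m) * (f - \<beta> p) - \<phi> s (f - \<beta> p) =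
          \<beta> (?\<delta> p - const (s powi m) * p)"
        by (simp add: hom_diff[OF \<phi>(1)[OF s]] hom_diff[OF \<beta>(1)] hom_scale[OF \<beta>(1)] f[OF s]
            equivariant[OF s] right_diff_distrib)
      finally have "?\<delta> p - const (s powi m) * p \<in> aug_power N" by (rule reflect)
      then have "(s powi word_weight d w - s powi m) * Poly_Mapping.lookup p w = 0"
        using w(1) by (simp add: aug_power_def lookup_minus lookup_diagonal[OF s] left_diff_distrib)
      then show ?thesis using w(2) by simp
    qed
    then have "m = word_weight d w"
      using power_int_exponent_in[of "{()}" m "\<lambda>_. word_weight d w", where 'k = 'k] by auto
    then show ?thesis using word_weight_ge_length[of d w] pos by (simp add: b_def)
  qed
  have "\<exists>p. f - \<beta> p \<in> aug_power N \<and> (\<forall>w. b < word_length w \<longrightarrow> Poly_Mapping.lookup p w = 0)" for N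
  proof -
    obtain p where p: "f - \<beta> p \<in> aug_power N" using approx by blast
    \<comment> \<open>Truncation at length \<open>b\<close>; by \<open>short\<close> the discarded
      words have length at least \<open>N\<close>, so the approximation survives.\<close>
    define q where "q = Poly_Mapping.mapp (\<lambda>w c. if word_length w \<le> b then c else 0) p"
    have q: "Poly_Mapping.lookup q w = (if word_length w \<le> b then Poly_Mapping.lookup p w else 0)" for w
      by (simp add: q_def lookup_mapp when_def in_keys_iff)
    have "p - q \<in> aug_power N"
      using short[OF p] by (auto simp: aug_power_def lookup_minus q)
    then have "\<beta> (p - q) \<in> aug_power N" by (rule aug_power_hom[OF \<beta>(1,2)])
    from aug_power_add[OF p this] have "f - \<beta> q \<in> aug_power N"
      by (simp add: hom_diff[OF \<beta>(1)])
    then show ?thesis by (auto simp: q)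
  qed
  then obtain p where p: "\<And>N. f - \<beta> (p N) \<in> aug_power N"
    and p_short: "\<And>N w. b < word_length w \<Longrightarrow> Poly_Mapping.lookup (p N) w = 0"
    by metis
  \<comment> \<open>Two truncated approximations agree on words of length at most \<open>b\<close>
    by strictness and vanish on longer ones.\<close>
  have const_p: "p N = p (Suc b)" if N: "Suc b \<le> N" for N
  proof -
    have "(f - \<beta> (p (Suc b))) - (f - \<beta> (p N)) \<in> aug_power (Suc b)"
      using p[of "Suc b"] aug_power_mono[OF p N] by (rule aug_power_diff)
    then have "\<beta> (p N - p (Suc b)) \<in> aug_power (Suc b)" by (simp add: hom_diff[OF \<beta>(1)])
    then have "p N - p (Suc b) \<in> aug_power (Suc b)" by (rule reflect)
    then have "Poly_Mapping.lookup (p N) w = Poly_Mapping.lookup (p (Suc b)) w" for w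
      by (cases "word_length w \<le> b") (auto simp: aug_power_def lookup_minus p_short)
    then show ?thesis by (rule poly_mapping_eqI)
  qed
  have "f - \<beta> (p (Suc b)) \<in> aug_power N" for N
    using aug_power_mono[OF p[of "max N (Suc b)"], of N] const_p[of "max N (Suc b)"] by simp
  then have "f - \<beta> (p (Suc b)) = 0" by (rule aug_power_Inter)
  then show ?thesis by (auto simp: image_iff)
qed

lemma inj_of_invertible_linear_part:
  fixes \<beta> :: "('n::finite, 'k::field) free_algebra \<Rightarrow> ('n, 'k) free_algebra"
  assumes \<beta>: "alg_hom const const \<beta>" "\<And>i. const_term (\<beta> (gen i)) = 0"
    "invertible (linear_part \<beta>)"
  shows "inj \<beta>"
proof (rule injI)
  fix f g assume "\<beta> f = \<beta> g"
  then have "\<beta> (f - g) = 0" by (simp add: hom_diff[OF \<beta>(1)])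
  then have "f - g = 0"
    using filtered_iso_of_invertible_linear_part(1)[OF \<beta>] by (intro aug_power_Inter) simp
  then show "f = g" by simp
qed

section \<open>Regular torus actions\<close>

lemma laurent_eval_hom:
  assumes "t \<in> torus"
  shows "laurent_eval t 0 = 0" "laurent_eval t (p + q) = laurent_eval t p + laurent_eval t q"
    "laurent_eval t (p * q) = laurent_eval t p * laurent_eval t q" "laurent_eval t (const c) = c"
proof -
  have eq: "laurent_eval t = linear_extension id (\<lambda>a. character a t)"
    by (simp add: fun_eq_iff laurent_eval_def linear_extension_def)
  show "laurent_eval t 0 = 0" by (simp add: laurent_eval_def)
  show "laurent_eval t (p + q) = laurent_eval t p + laurent_eval t q"
    unfolding eq by (rule linear_extension_add) auto
  show "laurent_eval t (p * q) = laurent_eval t p * laurent_eval t q"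
    unfolding eq by (rule linear_extension_mult) (auto simp: character_add assms mult.commute)
  show "laurent_eval t (const c) = c"
    unfolding eq const_def by (simp add: linear_extension_single)
qed

text \<open>Specialization is the coaction followed by evaluation of the coefficients, which is
  multiplicative as a linear extension with central coefficients.\<close>

lemma alg_hom_specialize:
  fixes \<sigma> :: "('n, 'r::finite, 'k::field) coaction"
  assumes "alg_hom const (\<lambda>c. const (const c)) \<sigma>" "t \<in> torus"
  shows "alg_hom const const (specialize \<sigma> t)"
proof -
  define E :: "('n, ('r, 'k) laurent) free_algebra \<Rightarrow> ('n, 'k) free_algebra"
    where "E = linear_extension (\<lambda>p. const (laurent_eval t p)) (\<lambda>w. Poly_Mapping.single w 1)"
  have spec: "specialize \<sigma> t f = E (\<sigma> f)" for f
  proof (rule poly_mapping_eqI)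
    fix w
    have "Poly_Mapping.lookup (E g) w = laurent_eval t (Poly_Mapping.lookup g w)" for g
      by (auto simp: E_def linear_extension_def lookup_sum lookup_single when_def if_distrib
          sum.delta in_keys_iff laurent_eval_hom(1)[OF assms(2)] cong: if_cong)
    then show "Poly_Mapping.lookup (specialize \<sigma> t f) w = Poly_Mapping.lookup (E (\<sigma> f)) w"
      by (simp add: specialize_def map.rep_eq when_def laurent_eval_hom(1)[OF assms(2)])
  qed
  have "E (x * y) = E x * E y" for x y
    unfolding E_def
    by (rule linear_extension_mult)
      (auto simp: laurent_eval_hom assms(2) mult_single const_def single_add)
  moreover have "E (x + y) = E x + E y" for x y
    unfolding E_def by (rule linear_extension_add) (auto simp: laurent_eval_hom assms(2) const_add)
  moreover have "E (const (const c)) = const c" for c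
    unfolding E_def const_def[of "const c"]
    by (subst linear_extension_single) (simp_all add: laurent_eval_hom assms(2))
  ultimately show ?thesis using assms(1) by (simp add: alg_hom_def spec)
qed

text \<open>The component \<open>P a\<close> collects the coefficients of the Laurent monomial
  \<open>a\<close> in \<open>\<sigma> f\<close>. Evaluation at 1 recovers \<open>f\<close>, and
  comparing characters of \<open>t\<close> in \<sigma>(s)\<sigma>(t) = \<sigma>(st) shows that
  \<open>P a\<close> has weight \<open>a\<close>.\<close>

lemma weight_decomposition:
  fixes \<sigma> :: "('n, 'r::finite, 'k::alg_closed_field) coaction"
  assumes \<sigma>: "regular_action \<sigma>"
  obtains A P where "finite A" "f = (\<Sum>a\<in>A. P a)"
    "\<And>a s. a \<in> A \<Longrightarrow> s \<in> torus \<Longrightarrow> specialize \<sigma> s (P a) = const (character a s) * P a"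
proof -
  define A where "A = (\<Union>w\<in>Poly_Mapping.keys (\<sigma> f). Poly_Mapping.keys (Poly_Mapping.lookup (\<sigma> f) w))"
  define P where "P a = Poly_Mapping.map (\<lambda>p. Poly_Mapping.lookup p a) (\<sigma> f)" for a
  have A: "finite A" by (simp add: A_def)
  have P: "Poly_Mapping.lookup (P a) w = Poly_Mapping.lookup (Poly_Mapping.lookup (\<sigma> f) w) a" for a w
    by (simp add: P_def map.rep_eq when_def)
  have spec: "specialize \<sigma> t f = (\<Sum>a\<in>A. const (character a t) * P a)" for t
  proof (rule poly_mapping_eqI)
    fix w
    have "Poly_Mapping.lookup (specialize \<sigma> t f) w = laurent_eval t (Poly_Mapping.lookup (\<sigma> f) w)"
      by (simp add: specialize_def map.rep_eq when_def laurent_eval_def)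
    also have "\<dots> = (\<Sum>a\<in>A. Poly_Mapping.lookup (Poly_Mapping.lookup (\<sigma> f) w) a * character a t)"
      unfolding laurent_eval_def
    proof (intro sum.mono_neutral_left A)
      show "Poly_Mapping.keys (Poly_Mapping.lookup (\<sigma> f) w) \<subseteq> A"
        by (cases "w \<in> Poly_Mapping.keys (\<sigma> f)") (auto simp: A_def in_keys_iff)
    qed (auto simp: in_keys_iff)
    finally show "Poly_Mapping.lookup (specialize \<sigma> t f) w =
        Poly_Mapping.lookup (\<Sum>a\<in>A. const (character a t) * P a) w"
      by (simp add: lookup_sum P mult.commute)
  qed
  have hom: "alg_hom const const (specialize \<sigma> t)" if "t \<in> torus" for t
    using \<sigma> that by (auto simp: regular_action_def intro: alg_hom_specialize)
  show thesis
  proof (rule that[OF A])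
    show "f = (\<Sum>a\<in>A. P a)"
      using spec[of 1] \<sigma> by (simp add: regular_action_def)
  next
    fix a and s :: "'k ^ 'r" assume a: "a \<in> A" and s: "s \<in> torus"
    show "specialize \<sigma> s (P a) = const (character a s) * P a"
    proof (rule poly_mapping_eqI)
      fix w
      let ?c = "\<lambda>a. Poly_Mapping.lookup (specialize \<sigma> s (P a)) w -
        character a s * Poly_Mapping.lookup (P a) w"
      have "?c a = 0"
      proof (rule characters_independent[OF A _ a])
        fix t :: "'k ^ 'r" assume t: "t \<in> torus"
        have "(\<Sum>a\<in>A. const (character a t) * specialize \<sigma> s (P a)) =
            specialize \<sigma> s (specialize \<sigma> t f)"
          by (simp add: spec[of t] hom_sum[OF hom[OF s]] hom_scale[OF hom[OF s]])
        also have "\<dots> = specialize \<sigma> (s * t) f"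
          using \<sigma> s t by (auto simp: regular_action_def fun_eq_iff)
        also have "\<dots> = (\<Sum>a\<in>A. const (character a s * character a t) * P a)"
          by (simp add: spec[of "s * t"] character_mult)
        finally have "Poly_Mapping.lookup (\<Sum>a\<in>A. const (character a t) * specialize \<sigma> s (P a)) w =
            Poly_Mapping.lookup (\<Sum>a\<in>A. const (character a s * character a t) * P a) w"
          by simp
        then show "(\<Sum>a\<in>A. ?c a * character a t) = 0"
          by (simp add: lookup_sum algebra_simps sum_subtractf)
      qed
      then show "Poly_Mapping.lookup (specialize \<sigma> s (P a)) w =
          Poly_Mapping.lookup (const (character a s) * P a) w" by simp
    qed
  qed
qed

section \<open>Linearization\<close>

lemma poly_det:
  fixes M :: "'k::comm_ring_1 poly ^ 'n ^ 'n"
  shows "poly (det M) x = det (\<chi> i j. poly (M $ i $ j) x)"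
  by (simp add: det_def poly_sum poly_prod)

text \<open>Evaluation at \<open>\<mu>\<close> commutes with the determinant, and
  \<open>mat \<mu> - A\<close> is singular because it kills \<open>v\<close>.\<close>

lemma charpoly_eigenvalue:
  fixes A :: "'k::field ^ 'n ^ 'n"
  assumes v: "A *v v = \<mu> *s v" "v \<noteq> 0"
  shows "poly (charpoly A) \<mu> = 0"
proof -
  have "(\<chi> i j. poly ((mat [:0, 1:] - (\<chi> i j. [:A $ i $ j:])) $ i $ j) \<mu>) = mat \<mu> - A"
    by (simp add: vec_eq_iff mat_def)
  then have "poly (charpoly A) \<mu> = det (mat \<mu> - A)"
    by (simp add: charpoly_def poly_det)
  moreover have "(mat \<mu> - A) *v v = 0"
  proof -
    have "mat \<mu> *v v = \<mu> *s v"
      by (simp add: vec_eq_iff matrix_vector_mult_def mat_def if_distrib[of "\<lambda>x. x * _"] sum.delta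
          cong: if_cong)
    then show ?thesis by (simp add: matrix_vector_mult_diff_rdistrib v)
  qed
  ultimately show ?thesis
    using v(2) by (metis invertible_det_nz matrix_left_invertible_ker invertible_def)
qed

text \<open>A maximal independent subset of \<open>S\<close> has as many elements as the index type,
  so it can serve as the columns of a square matrix.\<close>

lemma spanning_image_basis:
  fixes S :: "('k::field ^ 'n) set"
  assumes "vec.span S = UNIV"
  shows "\<exists>e :: 'n::finite \<Rightarrow> 'k ^ 'n. range e \<subseteq> S \<and> invertible (\<chi> j i. e i $ j)"
proof -
  obtain B where B: "B \<subseteq> S" "vec.independent B" "S \<subseteq> vec.span B"
    using vec.maximal_independent_subset[of S] by blast
  have span: "vec.span B = UNIV"
    using assms vec.span_mono[OF B(3)] by (simp add: vec.span_span top.extremum_uniqueI)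
  have "finite B" using B(2) by (rule vec.finiteI_independent)
  moreover have "card B = CARD('n)"
    using vec.dim_eq_card[of B UNIV] span B(2) vec_dim_card[where 'a = 'k and 'n = 'n]
    by (simp add: vec.span_UNIV del: vec.dim_UNIV)
  ultimately obtain e where e: "bij_betw e (UNIV :: 'n set) B"
    by (metis finite_same_card_bij finite)
  have "columns (\<chi> j i. e i $ j) = range e"
    by (auto simp: columns_def column_def vec_nth_inverse)
  then have "vec.span (columns (\<chi> j i. e i $ j)) = UNIV"
    using e span by (simp add: bij_betw_def)
  then have "invertible (\<chi> j i. e i $ j)"
    by (metis matrix_right_invertible_span_columns invertible_right_inverse)
  then show ?thesis using e B(1) by (auto simp: bij_betw_def)
qed

lemma alg_hom_translation: "alg_hom const const (translation c)"
  by (simp add: translation_def alg_hom_subst)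

lemma translation_inverse: "translation (- c) \<circ> translation c = id"
proof (rule alg_hom_eqI)
  show "(translation (- c) \<circ> translation c) (gen i) = id (gen i)" for i
  proof -
    have "translation (- c) (gen i - const (c $ i)) = (gen i - const (- c $ i)) - const (c $ i)"
      by (simp add: hom_diff[OF alg_hom_translation] hom_const[OF alg_hom_translation])
        (simp add: translation_def)
    also have "\<dots> = gen i - const (- c $ i + c $ i)"
      by (simp only: const_add diff_diff_eq)
    finally show ?thesis by (simp add: translation_def)
  qed
qed (rule alg_hom_comp[OF alg_hom_translation alg_hom_translation] alg_hom_id)+

lemma character_diagonal:
  fixes s :: "'k::field"
  assumes "s \<noteq> 0"
  shows "character a (\<chi> j. s) = s powi (\<Sum>j\<in>UNIV. a $ j)"
proof -
  have "(\<Prod>j\<in>J. s powi (a $ j)) = s powi (\<Sum>j\<in>J. a $ j)" for J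
    using assms by (induction J rule: infinite_finite_induct) (auto simp: power_int_add)
  then show ?thesis by (simp add: character_def)
qed

text \<open>Removing the constant term leaves an element of the augmentation ideal, which \<phi>
  preserves.\<close>

lemma const_term_hom:
  fixes \<phi> :: "('n, 'k::field) free_algebra \<Rightarrow> ('n, 'k) free_algebra"
  assumes \<phi>: "alg_hom const const \<phi>" "\<And>i. const_term (\<phi> (gen i)) = 0"
  shows "const_term (\<phi> f) = const_term f"
proof -
  have "const_term (f - const (const_term f)) = 0"
    by (simp add: const_term_def const_def lookup_minus)
  then have "\<phi> (f - const (const_term f)) \<in> aug_power (Suc 0)"
    by (intro aug_power_hom[OF \<phi>]) (simp add: aug_power_1)
  then have "const_term (\<phi> f - const (const_term f)) = 0"
    by (simp add: aug_power_1 hom_diff[OF \<phi>(1)] hom_const[OF \<phi>(1)])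
  then show ?thesis
    by (simp add: const_term_def const_def lookup_minus)
qed

theorem theorem1p3:
  fixes \<sigma> :: "('n::finite, 'r::finite, 'k::alg_closed_field) coaction"
  assumes "regular_action \<sigma>"
    and "effective \<sigma>"
    and "positive_roots \<sigma>"
  shows "linearizable \<sigma>"
proof -
  obtain c and k :: "'n \<Rightarrow> int ^ 'r"
    where augmented: "\<And>t i. t \<in> torus \<Longrightarrow> const_term (translated c (specialize \<sigma> t) (gen i)) = 0"
      and eigenvalues: "\<And>t. t \<in> torus \<Longrightarrow>
        has_eigenvalues (linear_part (translated c (specialize \<sigma> t))) (\<lambda>i. character (k i) t)"
      and k: "\<And>i j. 0 \<le> k i $ j" "\<And>i. \<exists>j. k i $ j \<noteq> 0"
    using assms(3) unfolding positive_roots_def by blast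
  \<comment> \<open>The action in the translated generators, which preserves the augmentation ideal;
    \<open>T\<close> and \<open>T'\<close> carry weight vectors back and forth.\<close>
  define \<tau> where "\<tau> t = translated c (specialize \<sigma> t)" for t
  define T :: "('n, 'k) free_algebra \<Rightarrow> ('n, 'k) free_algebra" where "T = translation c"
  define T' :: "('n, 'k) free_algebra \<Rightarrow> ('n, 'k) free_algebra" where "T' = translation (- c)"
  have T: "alg_hom const const T" and T': "alg_hom const const T'"
    by (simp_all add: T_def T'_def alg_hom_translation)
  have T'T: "T' (T f) = f" and TT': "T (T' f) = f" for f
    using translation_inverse[of c] translation_inverse[of "- c"]
    by (simp_all add: T_def T'_def fun_eq_iff)
  have \<tau>_eq: "\<tau> t f = T' (specialize \<sigma> t (T f))" for t f
    by (simp add: \<tau>_def translated_def T_def T'_def)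
  have hom: "alg_hom const const (\<tau> t)" if "t \<in> torus" for t
  proof -
    have "\<tau> t = T' \<circ> (specialize \<sigma> t \<circ> T)" by (simp add: fun_eq_iff \<tau>_eq)
    moreover have "alg_hom const const (specialize \<sigma> t)"
      using assms(1) that by (auto simp: regular_action_def intro: alg_hom_specialize)
    ultimately show ?thesis using T T' by (simp add: alg_hom_def)
  qed
  note augmented = augmented[folded \<tau>_def]
  note eigenvalues = eigenvalues[folded \<tau>_def]
  define W where "W a f \<longleftrightarrow> (\<forall>t\<in>torus. \<tau> t f = const (character a t) * f)" for a f
  have decomposition: "\<exists>A P. finite A \<and> f = (\<Sum>a\<in>A. P a) \<and> (\<forall>a\<in>A. W a (P a))" for f
  proof -
    obtain A P where A: "finite A" "T f = (\<Sum>a\<in>A. P a)"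
      and P: "\<And>a s. a \<in> A \<Longrightarrow> s \<in> torus \<Longrightarrow> specialize \<sigma> s (P a) = const (character a s) * P a"
      using weight_decomposition[OF assms(1), of "T f"] by metis
    have "f = (\<Sum>a\<in>A. T' (P a))"
      using T'T[of f] by (simp add: A(2) hom_sum[OF T'])
    moreover have "W a (T' (P a))" if "a \<in> A" for a
      using P[OF that] by (simp add: W_def \<tau>_eq TT' hom_scale[OF T'])
    ultimately show ?thesis using A(1) by (intro exI[of _ A] exI[of _ "\<lambda>a. T' (P a)"]) simp
  qed

  \<comment> \<open>The exponent of a character restricted to the diagonal of the torus. It turns
    the sign condition on the roots into positivity of one integer.\<close>
  define deg :: "int ^ 'r \<Rightarrow> int" where "deg a = (\<Sum>j\<in>UNIV. a $ j)" for a
  have diag_torus: "(\<chi> j. s) \<in> (torus :: ('k ^ 'r) set)" if "s \<noteq> 0" for s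
    using that by (simp add: torus_def)
  have W_diag: "\<tau> (\<chi> j. s) f = const (s powi deg a) * f" if "W a f" "s \<noteq> 0" for a f s
    using that diag_torus[of s] by (simp add: W_def deg_def character_diagonal)
  have deg_k: "0 < deg (k i)" for i
  proof -
    obtain j where "k i $ j \<noteq> 0" using k(2) by blast
    then have "0 < k i $ j" using k(1)[of i j] by simp
    then show ?thesis unfolding deg_def using k(1) by (intro sum_pos2[of UNIV j]) auto
  qed
  have deg_pos: "0 < deg a" if f: "W a f" "linear_coeffs f \<noteq> 0" for a f
  proof -
    \<comment> \<open>For each \<open>s\<close> the linear coefficients of \<open>f\<close> form an
      eigenvector, so \<open>s powi deg a\<close> is among the prescribed eigenvalues; equality for
      all \<open>s\<close> fixes the exponent.\<close>
    have "\<exists>i\<in>UNIV. deg a = deg (k i)"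
    proof (rule power_int_exponent_in)
      fix s :: 'k assume s: "s \<noteq> 0"
      let ?A = "linear_part (\<tau> (\<chi> j. s))"
      note t = diag_torus[OF s]
      have "?A *v linear_coeffs f = (s powi deg a) *s linear_coeffs f"
        using linear_coeffs_hom[OF hom[OF t] augmented[OF t], of f] W_diag[OF f(1) s]
        by (simp add: linear_coeffs_scale)
      then have "poly (charpoly ?A) (s powi deg a) = 0" using f(2) by (rule charpoly_eigenvalue)
      then show "\<exists>i\<in>UNIV. s powi deg a = s powi deg (k i)"
        using eigenvalues[OF t] s
        by (auto simp: has_eigenvalues_def poly_prod character_diagonal deg_def)
    qed simp
    then show ?thesis using deg_k by auto
  qed

  define S where "S = {linear_coeffs f | a f. W a f}"
  have "vec.span S = UNIV"
  proof -
    have span: "linear_coeffs f \<in> vec.span S" for f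
    proof -
      obtain A P where f: "f = (\<Sum>a\<in>A. P a)" and "\<forall>a\<in>A. W a (P a)"
        using decomposition by metis
      then show ?thesis
        unfolding f linear_coeffs_sum by (intro vec.span_sum vec.span_base) (auto simp: S_def)
    qed
    \<comment> \<open>Any vector comes from a combination of generators, and its weight components
      supply elements of \<open>S\<close>.\<close>
    have "v = linear_coeffs (\<Sum>i\<in>UNIV. const (v $ i) * gen i)" for v :: "'k ^ 'n"
      by (simp add: linear_coeffs_sum linear_coeffs_scale linear_coeffs_gen vec_eq_iff axis_def
          if_distrib sum.delta cong: if_cong)
    then have "v \<in> vec.span S" for v by (rule ssubst) (rule span)
    then show ?thesis by blast
  qed
  from spanning_image_basis[OF this] obtain e :: "'n \<Rightarrow> 'k ^ 'n"
    where e: "range e \<subseteq> S" "invertible (\<chi> j i. e i $ j)"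
    by blast
  have "\<forall>i. \<exists>a f. W a f \<and> e i = linear_coeffs f" using e(1) unfolding S_def by fast
  then obtain wt y where y: "\<And>i. W (wt i) (y i)" "\<And>i. e i = linear_coeffs (y i)"
    by metis
  define \<beta> where "\<beta> = subst y"
  have \<beta>: "alg_hom const const \<beta>" by (simp add: \<beta>_def alg_hom_subst)
  have \<beta>_gen: "\<beta> (gen i) = y i" for i by (simp add: \<beta>_def)
  have linear_part_\<beta>: "linear_part \<beta> = (\<chi> j i. e i $ j)"
    by (simp add: vec_eq_iff linear_part_gen \<beta>_gen y(2))
  have deg_wt: "0 < deg (wt i)" for i
  proof (rule deg_pos[OF y(1)])
    show "linear_coeffs (y i) \<noteq> 0"
    proof
      assume "linear_coeffs (y i) = 0"
      then have "(\<chi> j i. e i $ j) *v axis i 1 = 0"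
        by (simp add: y(2) vec_eq_iff matrix_vector_mult_def axis_def if_distrib sum.delta
            cong: if_cong)
      moreover have "\<exists>B. B ** (\<chi> j i. e i $ j) = mat 1" using e(2) by (auto simp: invertible_def)
      ultimately have "axis i (1 :: 'k) = 0" unfolding matrix_left_invertible_ker by blast
      then show False by (simp add: axis_eq_0_iff)
    qed
  qed
  \<comment> \<open>The action fixes the constant term of \<open>y i\<close> but also scales it by a
    power of positive degree, so it must vanish.\<close>
  have \<beta>_augmented: "const_term (\<beta> (gen i)) = 0" for i
  proof (rule ccontr)
    assume nz: "const_term (\<beta> (gen i)) \<noteq> 0"
    have "\<exists>u\<in>{()}. deg (wt i) = 0"
    proof (rule power_int_exponent_in)
      fix s :: 'k assume s: "s \<noteq> 0"
      note t = diag_torus[OF s]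
      have "const_term (y i) = s powi deg (wt i) * const_term (y i)"
        using const_term_hom[OF hom[OF t] augmented[OF t], of "y i"] W_diag[OF y(1) s, of i]
        by (simp add: const_term_def)
      then show "\<exists>u\<in>{()}. s powi deg (wt i) = s powi 0" using nz by (simp add: \<beta>_gen)
    qed simp
    then show False using deg_wt[of i] by simp
  qed
  note \<beta>_iso = \<beta> \<beta>_augmented e(2)[folded linear_part_\<beta>]
  have in_range: "f \<in> range \<beta>" if "W a f" for a f
    using weight_vector_in_range[OF \<beta>_iso, of "\<lambda>s. \<tau> (\<chi> j. s)" "\<lambda>i. deg (wt i)" f "deg a"]
      hom augmented diag_torus W_diag y(1) that deg_wt by (simp add: \<beta>_gen)
  have "f \<in> range \<beta>" for f
  proof -
    obtain A P where A: "f = (\<Sum>a\<in>A. P a)" "\<forall>a\<in>A. W a (P a)" using decomposition by metis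
    then have "\<forall>a\<in>A. \<exists>g. P a = \<beta> g" using in_range by blast
    then obtain g where "\<forall>a\<in>A. P a = \<beta> (g a)" by metis
    then have "f = \<beta> (\<Sum>a\<in>A. g a)" by (simp add: A(1) hom_sum[OF \<beta>])
    then show ?thesis by blast
  qed
  then have "bij \<beta>"
    using inj_of_invertible_linear_part[OF \<beta>_iso] by (auto simp: bij_def)
  moreover have "bij T" using T'T TT' by (intro bij_betw_byWitness[of _ T']) auto
  ultimately have bij: "bij (T \<circ> \<beta>)" by (rule bij_comp)
  \<comment> \<open>\<open>T \<circ> \<beta>\<close> sends each generator to \<open>T (y i)\<close>,
    a weight vector for \<sigma> itself, so the conjugated action is diagonal.\<close>
  have "linear_endo (inv (T \<circ> \<beta>) \<circ> specialize \<sigma> t \<circ> (T \<circ> \<beta>))" if t: "t \<in> torus" for t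
    unfolding linear_endo_def
  proof (intro allI exI)
    fix i
    have "specialize \<sigma> t ((T \<circ> \<beta>) (gen i)) = T (\<tau> t (y i))"
      by (simp add: \<beta>_gen \<tau>_eq TT')
    also have "\<dots> = (T \<circ> \<beta>) (const (character (wt i) t) * gen i)"
      using y(1)[of i] t by (simp add: W_def hom_scale[OF T] hom_scale[OF \<beta>] \<beta>_gen)
    finally have "(inv (T \<circ> \<beta>) \<circ> specialize \<sigma> t \<circ> (T \<circ> \<beta>)) (gen i) =
        const (character (wt i) t) * gen i"
      by (simp only: o_apply[of _ "T \<circ> \<beta>"] o_apply[of "inv (T \<circ> \<beta>)"] inv_f_f[OF bij_is_inj[OF bij]])
    also have "\<dots> = (\<Sum>j\<in>UNIV. const (if j = i then character (wt i) t else 0) * gen j)"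
    proof -
      have "(\<Sum>j\<in>UNIV. const (if j = i then character (wt i) t else 0) * gen j) =
          (\<Sum>j\<in>UNIV. if j = i then const (character (wt i) t) * gen j else 0)"
        by (intro sum.cong) auto
      then show ?thesis by simp
    qed
    finally show "(inv (T \<circ> \<beta>) \<circ> specialize \<sigma> t \<circ> (T \<circ> \<beta>)) (gen i) =
        (\<Sum>j\<in>UNIV. const (if j = i then character (wt i) t else 0) * gen j)" .
  qed
  moreover have "free_algebra_aut (T \<circ> \<beta>)"
    using alg_hom_comp[OF \<beta> T] bij by (simp add: free_algebra_aut_def)
  ultimately show ?thesis unfolding linearizable_def by blast
qed

end
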